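(* Consider the random graph mixture model with $\kappa$-state edge variables and $Q\ge 2$ groups. If $\kappa\ge\binom{Q+1}2$ and the $\kappa$-entry vectors $\{\mathbf p_{ql}\}_{1\le q\le l\le Q}$ are linearly independent, then the parameters $\boldsymbol\pi$ and $\{\mathbf p_{ql}\}_{1\le q\le l\le Q}$ are identifiable, up to label swapping, from the joint distribution of $K_9$.
   Context: Random graph mixture model: nodes have i.i.d. latent groups $Z_i\in\{1,\dots,Q\}$ with $\pi_q=\mathbb P(Z_i=q)\in(0,1)$, $\sum_q\pi_q=1$; edge variables $X_{ij}$ ($i<j$) are conditionally independent given all $Z$'s, with law of $X_{ij}$ depending only on $(Z_i,Z_j)$. In the $\kappa$-state model, $X_{ij}\in\{1,\dots,\kappa\}$ and $\mathbf p_{ql}=(p_{ql}(1),\dots,p_{ql}(\kappa))$ with $p_{ql}(k)=\mathbb P(X_{ij}=k\mid Z_i=q,Z_j=l)$, $\sum_kp_{ql}(k)=1$, and $\mathbf p_{ql}=\mathbf p_{lq}$. $K_n$ denotes the collection of the $\binom n2$ edge variables among $n$ nodes. "Up to label swapping" means up to a permutation of $\{1,\dots,Q\}$ applied simultaneously to all group-indexed parameters. *)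

theory Defs
  imports Complex_Main "HOL-Library.FuncSet" "HOL-Combinatorics.Permutations"
begin

text \<open>Groups are indexed by 0..<Q, edge states by 0..<kappa, nodes by 0..<n.
  pi q = P(Z_i = q); p q l k = P(X_ij = k | Z_i = q, Z_j = l).\<close>

definition valid_params :: "nat \<Rightarrow> nat \<Rightarrow> (nat \<Rightarrow> real) \<Rightarrow> (nat \<Rightarrow> nat \<Rightarrow> nat \<Rightarrow> real) \<Rightarrow> bool" where
  "valid_params Q \<kappa> \<pi> p \<longleftrightarrow>
     (\<forall>q<Q. 0 < \<pi> q \<and> \<pi> q < 1) \<and> (\<Sum>q<Q. \<pi> q) = 1 \<and>
     (\<forall>q<Q. \<forall>l<Q. \<forall>k<\<kappa>. 0 \<le> p q l k) \<and>
     (\<forall>q<Q. \<forall>l<Q. (\<Sum>k<\<kappa>. p q l k) = 1) \<and>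
     (\<forall>q<Q. \<forall>l<Q. \<forall>k<\<kappa>. p q l k = p l q k)"

definition node_pairs :: "nat \<Rightarrow> (nat \<times> nat) set" where
  "node_pairs n = {(i, j). i < j \<and> j < n}"

definition joint_prob :: "nat \<Rightarrow> nat \<Rightarrow> (nat \<Rightarrow> real) \<Rightarrow> (nat \<Rightarrow> nat \<Rightarrow> nat \<Rightarrow> real)
    \<Rightarrow> (nat \<times> nat \<Rightarrow> nat) \<Rightarrow> real" where
  "joint_prob n Q \<pi> p x =
     (\<Sum>z \<in> {..<n} \<rightarrow>\<^sub>E {..<Q}.
        (\<Prod>i<n. \<pi> (z i)) * (\<Prod>(i, j) \<in> node_pairs n. p (z i) (z j) (x (i, j))))"

definition lin_indep_ql :: "nat \<Rightarrow> nat \<Rightarrow> (nat \<Rightarrow> nat \<Rightarrow> nat \<Rightarrow> real) \<Rightarrow> bool" where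
  "lin_indep_ql Q \<kappa> p \<longleftrightarrow>
     (\<forall>c :: nat \<Rightarrow> nat \<Rightarrow> real.
        (\<forall>k<\<kappa>. (\<Sum>(q, l) \<in> {(q, l). q \<le> l \<and> l < Q}. c q l * p q l k) = 0)
        \<longrightarrow> (\<forall>q l. q \<le> l \<and> l < Q \<longrightarrow> c q l = 0))"

end

theory Submission
  imports Defs
begin

(* Idea: every mixed moment E[\<Prod>_e \<psi>_e(X_e)] of the edge variables is determined by the
   joint law. Conditioning on the group labels expresses the moments of small trees in K_n
   through the "edge means" \<Sum>_k \<phi>(k) p_ab(k) and the "node means" \<Sum>_c \<pi>_c (edge mean).
   Linear independence of the vectors p_ql (q \<le> l) provides, by a dual basis, test functions
   f t whose edge mean is the indicator of the pair (t, t). Star moments of orders 1, 2 and 4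
   in the f t show that the node means of f t under the second parameter set are \<pi> t times
   the indicator of a single group \<sigma> t, with \<sigma> a permutation and \<pi>' (\<sigma> t) = \<pi> t.
   A tree moment with a unit vector on one edge then gives p'_{\<sigma> q \<sigma> l} = p_ql. *)

definition dot :: "nat \<Rightarrow> (nat \<Rightarrow> real) \<Rightarrow> (nat \<Rightarrow> real) \<Rightarrow> real" where
  "dot \<kappa> f v = (\<Sum>k<\<kappa>. f k * v k)"

definition lin_indep_on :: "nat \<Rightarrow> 'i set \<Rightarrow> ('i \<Rightarrow> nat \<Rightarrow> real) \<Rightarrow> bool" where
  "lin_indep_on \<kappa> I v \<longleftrightarrow>
     (\<forall>c. (\<forall>k<\<kappa>. (\<Sum>i\<in>I. c i * v i k) = 0) \<longrightarrow> (\<forall>i\<in>I. c i = 0))"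

lemma dot_unit:
  assumes "k < \<kappa>"
  shows "dot \<kappa> (\<lambda>k'. if k' = k then 1 else 0) w = w k"
proof -
  have "dot \<kappa> (\<lambda>k'. if k' = k then 1 else 0) w = (\<Sum>k'<\<kappa>. if k' = k then w k' else 0)"
    unfolding dot_def by (intro sum.cong) auto
  then show ?thesis using assms by simp
qed

lemma dot_lincomb:
  "dot \<kappa> (\<lambda>k. \<Sum>j\<in>J. c j * g j k) w = (\<Sum>j\<in>J. c j * dot \<kappa> (g j) w)"
  unfolding dot_def by (simp add: sum_distrib_left sum_distrib_right mult.assoc sum.swap[of _ J])

lemma dot_diff: "dot \<kappa> (\<lambda>k. f k - g k) w = dot \<kappa> f w - dot \<kappa> g w"
  unfolding dot_def by (simp add: left_diff_distrib sum_subtractf)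

lemma dot_scale: "dot \<kappa> (\<lambda>k. c * f k) w = c * dot \<kappa> f w"
  unfolding dot_def by (simp add: sum_distrib_left mult.assoc)

lemma lin_indep_on_subset:
  assumes "lin_indep_on \<kappa> I v" "J \<subseteq> I" "finite I"
  shows "lin_indep_on \<kappa> J v"
  unfolding lin_indep_on_def
proof (intro allI impI)
  fix c assume rel: "\<forall>k<\<kappa>. (\<Sum>i\<in>J. c i * v i k) = 0"
  define c' where "c' i = (if i \<in> J then c i else 0)" for i
  have "(\<Sum>i\<in>I. c' i * v i k) = (\<Sum>i\<in>J. c i * v i k)" for k
    using assms(2,3) by (subst sum.mono_neutral_right[of I J]) (auto simp: c'_def)
  then have "\<forall>i\<in>I. c' i = 0" using assms(1) rel unfolding lin_indep_on_def by metis
  then show "\<forall>i\<in>J. c i = 0" using assms(2) unfolding c'_def by (metis subsetD)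
qed

(* If v a is independent of the v i (i \<in> I) and the latter admit a dual family g, then
   some functional kills all v i but not v a: otherwise the residuals of the unit vectors
   after projecting along the g j would all kill v a, expressing v a through the v i. *)
lemma annihilator_exists:
  assumes "finite I" "a \<notin> I" "lin_indep_on \<kappa> (insert a I) v"
    and dual: "\<forall>j\<in>I. \<forall>i\<in>I. dot \<kappa> (g j) (v i) = (if i = j then 1 else 0)"
  shows "\<exists>f. (\<forall>i\<in>I. dot \<kappa> f (v i) = 0) \<and> dot \<kappa> f (v a) \<noteq> 0"
proof (rule ccontr)
  assume none: "\<not> ?thesis"
  define r where "r k = (\<lambda>k'. (if k' = k then 1 else 0) - (\<Sum>j\<in>I. v j k * g j k'))" for k
  have dot_r: "dot \<kappa> (r k) w = w k - (\<Sum>j\<in>I. v j k * dot \<kappa> (g j) w)" if "k < \<kappa>" for k w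
    unfolding r_def dot_diff dot_lincomb dot_unit[OF that] ..
  have expand: "v a k = (\<Sum>j\<in>I. v j k * dot \<kappa> (g j) (v a))" if k: "k < \<kappa>" for k
  proof -
    have "dot \<kappa> (r k) (v i) = 0" if "i \<in> I" for i
    proof -
      have "(\<Sum>j\<in>I. v j k * dot \<kappa> (g j) (v i)) = (\<Sum>j\<in>I. if j = i then v j k else 0)"
        using dual that by (intro sum.cong) auto
      then show ?thesis using that assms(1) dot_r[OF k] by simp
    qed
    then have "dot \<kappa> (r k) (v a) = 0" using none by blast
    then show ?thesis using dot_r[OF k] by simp
  qed
  define c where "c i = (if i = a then 1 else - dot \<kappa> (g i) (v a))" for i
  have "(\<Sum>i\<in>insert a I. c i * v i k) = 0" if "k < \<kappa>" for k
  proof -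
    have "(\<Sum>i\<in>I. c i * v i k) = - (\<Sum>j\<in>I. v j k * dot \<kappa> (g j) (v a))"
      using assms(2) by (auto simp: c_def sum_negf[symmetric] intro: sum.cong)
    then show ?thesis using assms(1,2) expand[OF that] by (simp add: c_def)
  qed
  then have "c a = 0" using assms(3) unfolding lin_indep_on_def by blast
  then show False by (simp add: c_def)
qed

lemma dual_basis_exists:
  assumes "finite I" "lin_indep_on \<kappa> I v"
  shows "\<exists>g. \<forall>j\<in>I. \<forall>i\<in>I. dot \<kappa> (g j) (v i) = (if i = j then 1 else 0)"
  using assms
proof (induction I rule: finite_induct)
  case empty
  then show ?case by simp
next
  case (insert a I)
  (* Extend a dual family g of I by the normalised annihilator fa of the v i and
     correct each g j by a multiple of fa so that it kills v a. *)
  obtain g where g: "\<forall>j\<in>I. \<forall>i\<in>I. dot \<kappa> (g j) (v i) = (if i = j then 1 else 0)"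
    using insert.IH lin_indep_on_subset[OF insert.prems] insert.hyps(1) by blast
  obtain f where f: "\<forall>i\<in>I. dot \<kappa> f (v i) = 0" "dot \<kappa> f (v a) \<noteq> 0"
    using annihilator_exists[OF insert.hyps(1,2) insert.prems g] by blast
  define fa where "fa k = f k / dot \<kappa> f (v a)" for k
  have dot_fa: "dot \<kappa> fa (v i) = (if i = a then 1 else 0)" if "i \<in> insert a I" for i
    using that f insert.hyps(2) unfolding fa_def dot_def by (auto simp: sum_divide_distrib[symmetric])
  define g' where "g' j = (if j = a then fa else (\<lambda>k. g j k - dot \<kappa> (g j) (v a) * fa k))" for j
  have "dot \<kappa> (g' j) (v i) = (if i = j then 1 else 0)" if "j \<in> insert a I" "i \<in> insert a I" for i j
    using that g dot_fa insert.hyps(2) by (auto simp: g'_def dot_diff dot_scale)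
  then show ?case by blast
qed

definition edge_mean :: "nat \<Rightarrow> (nat \<Rightarrow> nat \<Rightarrow> nat \<Rightarrow> real) \<Rightarrow> (nat \<Rightarrow> real) \<Rightarrow> nat \<Rightarrow> nat \<Rightarrow> real" where
  "edge_mean \<kappa> p \<phi> a b = (\<Sum>k<\<kappa>. \<phi> k * p a b k)"

definition node_mean :: "nat \<Rightarrow> nat \<Rightarrow> (nat \<Rightarrow> real) \<Rightarrow> (nat \<Rightarrow> nat \<Rightarrow> nat \<Rightarrow> real) \<Rightarrow>
    (nat \<Rightarrow> real) \<Rightarrow> nat \<Rightarrow> real" where
  "node_mean Q \<kappa> \<pi> p \<phi> a = (\<Sum>c<Q. \<pi> c * edge_mean \<kappa> p \<phi> a c)"

definition moment :: "nat \<Rightarrow> nat \<Rightarrow> nat \<Rightarrow> (nat \<Rightarrow> real) \<Rightarrow> (nat \<Rightarrow> nat \<Rightarrow> nat \<Rightarrow> real) \<Rightarrow>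
    (nat \<times> nat \<Rightarrow> nat \<Rightarrow> real) \<Rightarrow> real" where
  "moment n Q \<kappa> \<pi> p \<psi> = (\<Sum>x \<in> node_pairs n \<rightarrow>\<^sub>E {..<\<kappa>}.
      (\<Prod>e \<in> node_pairs n. \<psi> e (x e)) * joint_prob n Q \<pi> p x)"

lemma finite_node_pairs: "finite (node_pairs n)"
  by (rule finite_subset[of _ "{..<n} \<times> {..<n}"]) (auto simp: node_pairs_def)

(* Conditioning on the group labels: given Z = z the edges are independent, so the
   moment becomes an average over labellings of a product of edge means. *)
lemma moment_factorizes:
  "moment n Q \<kappa> \<pi> p \<psi> = (\<Sum>z \<in> {..<n} \<rightarrow>\<^sub>E {..<Q}.
      (\<Prod>i<n. \<pi> (z i)) * (\<Prod>e \<in> node_pairs n. edge_mean \<kappa> p (\<psi> e) (z (fst e)) (z (snd e))))"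
proof -
  let ?X = "node_pairs n \<rightarrow>\<^sub>E {..<\<kappa>}" and ?Z = "{..<n} \<rightarrow>\<^sub>E {..<Q}"
  have "moment n Q \<kappa> \<pi> p \<psi> = (\<Sum>z\<in>?Z. (\<Prod>i<n. \<pi> (z i)) *
      (\<Sum>x\<in>?X. \<Prod>e\<in>node_pairs n. \<psi> e (x e) * p (z (fst e)) (z (snd e)) (x e)))"
    unfolding moment_def joint_prob_def
    by (simp add: case_prod_unfold sum_distrib_left sum_distrib_right prod.distrib mult_ac
        sum.swap[of _ ?X])
  also have "\<dots> = (\<Sum>z\<in>?Z. (\<Prod>i<n. \<pi> (z i)) *
      (\<Prod>e\<in>node_pairs n. edge_mean \<kappa> p (\<psi> e) (z (fst e)) (z (snd e))))"
    unfolding edge_mean_def using finite_node_pairs by (simp add: prod_sum_PiE)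
  finally show ?thesis .
qed

lemma moment_eq_if_joint_eq:
  assumes "\<forall>x \<in> node_pairs n \<rightarrow>\<^sub>E {..<\<kappa>}. joint_prob n Q \<pi>' p' x = joint_prob n Q \<pi> p x"
  shows "moment n Q \<kappa> \<pi>' p' \<psi> = moment n Q \<kappa> \<pi> p \<psi>"
  unfolding moment_def using assms by (intro sum.cong) auto

lemma sum_PiE_insert:
  assumes "i \<notin> S"
  shows "(\<Sum>z \<in> PiE (insert i S) B. F z) = (\<Sum>y\<in>B i. \<Sum>g \<in> PiE S B. F (g(i := y)))"
proof -
  have "(\<Sum>z \<in> PiE (insert i S) B. F z) = (\<Sum>(y, g) \<in> B i \<times> PiE S B. F (g(i := y)))"
    unfolding PiE_insert_eq using inj_combinator[OF assms, of B]
    by (subst sum.reindex) (auto simp: case_prod_unfold)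
  also have "\<dots> = (\<Sum>y\<in>B i. \<Sum>g \<in> PiE S B. F (g(i := y)))"
    by (rule sum.cartesian_product[symmetric])
  finally show ?thesis .
qed

(* Labels of nodes that the integrand does not look at integrate out, since \<Sum> \<pi> = 1. *)
lemma sum_labelings_marginal:
  fixes \<pi> :: "nat \<Rightarrow> real" and m n :: nat
  assumes sum_one: "(\<Sum>c<Q. \<pi> c) = 1" and "m \<le> n"
    and local: "\<And>z z'. (\<forall>i<m. z i = z' i) \<Longrightarrow> G z = G z'"
  shows "(\<Sum>z \<in> {..<n} \<rightarrow>\<^sub>E {..<Q}. (\<Prod>i<n. \<pi> (z i)) * G z)
       = (\<Sum>z \<in> {..<m} \<rightarrow>\<^sub>E {..<Q}. (\<Prod>i<m. \<pi> (z i)) * G z)"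
  using \<open>m \<le> n\<close>
proof (induction n rule: nat_induct_at_least)
  case base
  then show ?case ..
next
  case (Suc n)
  have G_upd: "G (g(n := y)) = G g" for g y
    using Suc.hyps(1) by (intro local) auto
  have prod_upd: "(\<Prod>i<n. \<pi> ((g(n := y)) i)) = (\<Prod>i<n. \<pi> (g i))" for g y
    by (intro prod.cong) auto
  have "(\<Sum>z \<in> {..<Suc n} \<rightarrow>\<^sub>E {..<Q}. (\<Prod>i<Suc n. \<pi> (z i)) * G z)
      = (\<Sum>y<Q. \<Sum>g \<in> {..<n} \<rightarrow>\<^sub>E {..<Q}. \<pi> y * ((\<Prod>i<n. \<pi> (g i)) * G g))"
    unfolding lessThan_Suc
    by (simp add: sum_PiE_insert G_upd prod_upd mult_ac)
  also have "\<dots> = (\<Sum>g \<in> {..<n} \<rightarrow>\<^sub>E {..<Q}. (\<Prod>i<n. \<pi> (g i)) * G g)"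
    by (simp add: sum_distrib_left[symmetric] sum_distrib_right[symmetric] sum_one)
  finally show ?case using Suc.IH by simp
qed

(* Labelling sum for the tree on nodes 0..5 with edges 0-1, 0-2, 0-3, 0-4, 1-5: summing
   the labels of the leaves 2..5 yields the node means m w. *)
lemma sum_labelings_tree:
  fixes Q :: nat and \<pi> :: "nat \<Rightarrow> real" and w1 w2 w3 w4 w5 :: "nat \<Rightarrow> nat \<Rightarrow> real"
  defines "m w a \<equiv> (\<Sum>c<Q. \<pi> c * w a c)"
  shows "(\<Sum>z \<in> {..<6::nat} \<rightarrow>\<^sub>E {..<Q}. (\<Prod>i<6. \<pi> (z i)) *
      (w1 (z 0) (z 1) * w2 (z 0) (z 2) * w3 (z 0) (z 3) * w4 (z 0) (z 4) * w5 (z 1) (z 5)))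
    = (\<Sum>a<Q. \<pi> a * m w2 a * m w3 a * m w4 a * (\<Sum>b<Q. \<pi> b * w1 a b * m w5 b))"
proof -
  define S :: "nat set" where "S = {2, 3, 4, 5}"
  have six: "{..<6::nat} = insert 0 (insert 1 S)" unfolding S_def by auto
  define leaf where "leaf a b (i::nat) c = \<pi> c * (if i = 2 then w2 a c else if i = 3 then w3 a c
      else if i = 4 then w4 a c else w5 b c)" for a b i c
  have "(\<Sum>z \<in> {..<6::nat} \<rightarrow>\<^sub>E {..<Q}. (\<Prod>i<6. \<pi> (z i)) *
      (w1 (z 0) (z 1) * w2 (z 0) (z 2) * w3 (z 0) (z 3) * w4 (z 0) (z 4) * w5 (z 1) (z 5)))
    = (\<Sum>a<Q. \<Sum>b<Q. \<pi> a * \<pi> b * w1 a b * (\<Sum>g \<in> S \<rightarrow>\<^sub>E {..<Q}. \<Prod>i\<in>S. leaf a b i (g i)))"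
    unfolding six by (simp add: sum_PiE_insert S_def leaf_def sum_distrib_left mult_ac)
  also have "\<dots> = (\<Sum>a<Q. \<Sum>b<Q. \<pi> a * \<pi> b * w1 a b * (\<Prod>i\<in>S. \<Sum>c<Q. leaf a b i c))"
    by (simp add: prod_sum_PiE S_def)
  also have "\<dots> = (\<Sum>a<Q. \<Sum>b<Q. \<pi> a * \<pi> b * w1 a b * (m w2 a * m w3 a * m w4 a * m w5 b))"
    by (simp add: S_def leaf_def m_def mult.assoc)
  also have "\<dots> = (\<Sum>a<Q. \<pi> a * m w2 a * m w3 a * m w4 a * (\<Sum>b<Q. \<pi> b * w1 a b * m w5 b))"
    by (simp add: sum_distrib_left mult_ac)
  finally show ?thesis .
qed

definition tree_test :: "(nat \<Rightarrow> real) \<Rightarrow> (nat \<Rightarrow> real) \<Rightarrow> (nat \<Rightarrow> real) \<Rightarrow> (nat \<Rightarrow> real) \<Rightarrow>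
    (nat \<Rightarrow> real) \<Rightarrow> nat \<times> nat \<Rightarrow> nat \<Rightarrow> real" where
  "tree_test \<phi>1 \<phi>2 \<phi>3 \<phi>4 \<phi>5 e =
     (if e = (0, 1) then \<phi>1 else if e = (0, 2) then \<phi>2 else if e = (0, 3) then \<phi>3
      else if e = (0, 4) then \<phi>4 else if e = (1, 5) then \<phi>5 else (\<lambda>_. 1))"

lemma edge_mean_one:
  assumes "valid_params Q \<kappa> \<pi> p" "a < Q" "b < Q"
  shows "edge_mean \<kappa> p (\<lambda>_. 1) a b = 1"
  using assms unfolding edge_mean_def valid_params_def by simp

lemma moment_tree:
  assumes V: "valid_params Q \<kappa> \<pi> p" and "6 \<le> n"
  shows "moment n Q \<kappa> \<pi> p (tree_test \<phi>1 \<phi>2 \<phi>3 \<phi>4 \<phi>5) =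
    (\<Sum>a<Q. \<pi> a * node_mean Q \<kappa> \<pi> p \<phi>2 a * node_mean Q \<kappa> \<pi> p \<phi>3 a * node_mean Q \<kappa> \<pi> p \<phi>4 a *
       (\<Sum>b<Q. \<pi> b * edge_mean \<kappa> p \<phi>1 a b * node_mean Q \<kappa> \<pi> p \<phi>5 b))"
proof -
  let ?\<psi> = "tree_test \<phi>1 \<phi>2 \<phi>3 \<phi>4 \<phi>5" and ?w = "edge_mean \<kappa> p"
  define E :: "(nat \<times> nat) set" where "E = {(0, 1), (0, 2), (0, 3), (0, 4), (1, 5)}"
  define G where "G z = ?w \<phi>1 (z 0) (z 1) * ?w \<phi>2 (z 0) (z 2) * ?w \<phi>3 (z 0) (z 3) *
      ?w \<phi>4 (z 0) (z 4) * ?w \<phi>5 (z 1) (z 5)" for z :: "nat \<Rightarrow> nat"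
  have E_sub: "E \<subseteq> node_pairs n" using \<open>6 \<le> n\<close> by (auto simp: E_def node_pairs_def)
  have edges: "(\<Prod>e \<in> node_pairs n. ?w (?\<psi> e) (z (fst e)) (z (snd e))) = G z"
    if z: "z \<in> {..<n} \<rightarrow>\<^sub>E {..<Q}" for z
  proof -
    have "(\<Prod>e \<in> node_pairs n. ?w (?\<psi> e) (z (fst e)) (z (snd e)))
        = (\<Prod>e \<in> E. ?w (?\<psi> e) (z (fst e)) (z (snd e)))"
    proof (rule prod.mono_neutral_right[OF finite_node_pairs E_sub], rule ballI)
      fix e assume e: "e \<in> node_pairs n - E"
      then have "fst e < n" "snd e < n" by (auto simp: node_pairs_def)
      then have "z (fst e) < Q" "z (snd e) < Q" using z by auto
      moreover have "?\<psi> e = (\<lambda>_. 1)" using e by (auto simp: E_def tree_test_def)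
      ultimately show "?w (?\<psi> e) (z (fst e)) (z (snd e)) = 1" using edge_mean_one[OF V] by simp
    qed
    also have "\<dots> = G z" by (simp add: E_def G_def tree_test_def)
    finally show ?thesis .
  qed
  have sum_one: "(\<Sum>c<Q. \<pi> c) = 1" using V by (simp add: valid_params_def)
  have "moment n Q \<kappa> \<pi> p ?\<psi> = (\<Sum>z \<in> {..<n} \<rightarrow>\<^sub>E {..<Q}. (\<Prod>i<n. \<pi> (z i)) * G z)"
    unfolding moment_factorizes by (intro sum.cong) (simp_all add: edges)
  also have "\<dots> = (\<Sum>z \<in> {..<6} \<rightarrow>\<^sub>E {..<Q}. (\<Prod>i<6. \<pi> (z i)) * G z)"
    by (rule sum_labelings_marginal[OF sum_one \<open>6 \<le> n\<close>]) (simp add: G_def)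
  also have "\<dots> = (\<Sum>a<Q. \<pi> a * node_mean Q \<kappa> \<pi> p \<phi>2 a * node_mean Q \<kappa> \<pi> p \<phi>3 a * node_mean Q \<kappa> \<pi> p \<phi>4 a *
       (\<Sum>b<Q. \<pi> b * edge_mean \<kappa> p \<phi>1 a b * node_mean Q \<kappa> \<pi> p \<phi>5 b))"
    unfolding G_def node_mean_def by (rule sum_labelings_tree)
  finally show ?thesis .
qed

lemma node_mean_one:
  assumes "valid_params Q \<kappa> \<pi> p" "a < Q"
  shows "node_mean Q \<kappa> \<pi> p (\<lambda>_. 1) a = 1"
  using assms edge_mean_one[OF assms] unfolding node_mean_def valid_params_def by simp

(* With \<phi>5 = 1 the edge 1-5 disappears and the moment is that of the star at node 0. *)
lemma moment_star:
  assumes V: "valid_params Q \<kappa> \<pi> p" and "6 \<le> n"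
  shows "moment n Q \<kappa> \<pi> p (tree_test \<phi>1 \<phi>2 \<phi>3 \<phi>4 (\<lambda>_. 1)) =
    (\<Sum>a<Q. \<pi> a * node_mean Q \<kappa> \<pi> p \<phi>1 a * node_mean Q \<kappa> \<pi> p \<phi>2 a *
       node_mean Q \<kappa> \<pi> p \<phi>3 a * node_mean Q \<kappa> \<pi> p \<phi>4 a)"
proof -
  have "(\<Sum>b<Q. \<pi> b * edge_mean \<kappa> p \<phi>1 a b * node_mean Q \<kappa> \<pi> p (\<lambda>_. 1) b)
      = node_mean Q \<kappa> \<pi> p \<phi>1 a" for a
    unfolding node_mean_def[of Q \<kappa> \<pi> p \<phi>1] using node_mean_one[OF V] by (intro sum.cong) auto
  then show ?thesis unfolding moment_tree[OF assms] by (simp add: mult_ac)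
qed

lemma sum_lessThan_single:
  fixes F :: "nat \<Rightarrow> real"
  assumes "t < Q" "\<And>a. a < Q \<Longrightarrow> a \<noteq> t \<Longrightarrow> F a = 0"
  shows "(\<Sum>a<Q. F a) = F t"
  using assms by (subst sum.remove[of _ t]) (auto intro: sum.neutral)

(* By the independence of the p_ql (q \<le> l) and the symmetry p_ql = p_lq, there are test
   functions f t whose edge mean is 1 on the pair of groups (t, t) and 0 on all others. *)
lemma dual_test_functions:
  assumes V: "valid_params Q \<kappa> \<pi> p" and L: "lin_indep_ql Q \<kappa> p"
  shows "\<exists>f. \<forall>t<Q. \<forall>a<Q. \<forall>b<Q. edge_mean \<kappa> p (f t) a b = (if a = t \<and> b = t then 1 else 0)"
proof -
  define U where "U = {(q, l). q \<le> l \<and> l < Q}"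
  define v where "v e = p (fst e) (snd e)" for e
  have finU: "finite U"
    by (rule finite_subset[of _ "{..<Q} \<times> {..<Q}"]) (auto simp: U_def)
  have "lin_indep_on \<kappa> U v"
    unfolding lin_indep_on_def
  proof (intro allI impI)
    fix c :: "nat \<times> nat \<Rightarrow> real"
    assume "\<forall>k<\<kappa>. (\<Sum>e\<in>U. c e * v e k) = 0"
    then have "\<forall>k<\<kappa>. (\<Sum>(q, l) \<in> {(q, l). q \<le> l \<and> l < Q}. c (q, l) * p q l k) = 0"
      by (simp add: U_def v_def case_prod_unfold)
    then show "\<forall>e\<in>U. c e = 0"
      using L unfolding lin_indep_ql_def U_def by (fastforce elim!: allE[of _ "\<lambda>q l. c (q, l)"])
  qed
  then obtain g where g: "\<forall>j\<in>U. \<forall>i\<in>U. dot \<kappa> (g j) (v i) = (if i = j then 1 else 0)"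
    using dual_basis_exists[OF finU] by blast
  have "edge_mean \<kappa> p (g (t, t)) a b = (if a = t \<and> b = t then 1 else 0)"
    if "t < Q" "a < Q" "b < Q" for t a b
  proof (cases "a \<le> b")
    case True
    then show ?thesis using g that by (auto simp: U_def v_def dot_def edge_mean_def)
  next
    case False
    have "edge_mean \<kappa> p (g (t, t)) a b = edge_mean \<kappa> p (g (t, t)) b a"
      using V that unfolding edge_mean_def valid_params_def by (intro sum.cong) auto
    then show ?thesis using False g that by (auto simp: U_def v_def dot_def edge_mean_def)
  qed
  then show ?thesis by (intro exI[of _ "\<lambda>t. g (t, t)"]) blast
qed

lemma node_mean_dual:
  assumes "t < Q" and dual: "\<forall>b<Q. edge_mean \<kappa> p \<phi> a b = (if a = t \<and> b = t then 1 else 0)"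
  shows "node_mean Q \<kappa> \<pi> p \<phi> a = (if a = t then \<pi> t else 0)"
proof -
  have "node_mean Q \<kappa> \<pi> p \<phi> a = (\<Sum>c<Q. if c = t then (if a = t then \<pi> t else 0) else 0)"
    unfolding node_mean_def using dual by (intro sum.cong) auto
  then show ?thesis using \<open>t < Q\<close> by simp
qed

lemma support_permutation:
  fixes h :: "nat \<Rightarrow> nat \<Rightarrow> real"
  assumes nonzero: "\<And>t. t < Q \<Longrightarrow> \<exists>a<Q. h t a \<noteq> 0"
    and disjoint: "\<And>q s a. q < Q \<Longrightarrow> s < Q \<Longrightarrow> q \<noteq> s \<Longrightarrow> a < Q \<Longrightarrow> h q a * h s a = 0"
  shows "\<exists>\<sigma>. \<sigma> permutes {..<Q} \<and> (\<forall>t<Q. \<forall>a<Q. h t a \<noteq> 0 \<longleftrightarrow> a = \<sigma> t)"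
proof -
  define \<sigma> where "\<sigma> t = (if t < Q then (SOME a. a < Q \<and> h t a \<noteq> 0) else t)" for t
  have \<sigma>: "\<sigma> t < Q \<and> h t (\<sigma> t) \<noteq> 0" if "t < Q" for t
    using someI_ex[OF nonzero[OF that, unfolded Bex_def[symmetric]]] that
    by (simp add: \<sigma>_def Bex_def)
  have inj: "inj_on \<sigma> {..<Q}"
  proof (rule inj_onI, rule ccontr)
    fix q s assume "q \<in> {..<Q}" "s \<in> {..<Q}" "\<sigma> q = \<sigma> s" "q \<noteq> s"
    then show False using disjoint[of q s "\<sigma> q"] \<sigma>[of q] \<sigma>[of s] by auto
  qed
  have onto: "\<sigma> ` {..<Q} = {..<Q}" using \<sigma> inj by (intro endo_inj_surj) auto
  have perm: "\<sigma> permutes {..<Q}"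
    using inj onto by (intro bij_imp_permutes) (auto simp: bij_betw_def \<sigma>_def)
  have "h t a = 0" if "t < Q" "a < Q" "a \<noteq> \<sigma> t" for t a
  proof -
    obtain s where "s < Q" "a = \<sigma> s" using onto \<open>a < Q\<close> by (metis imageE lessThan_iff)
    then show ?thesis using disjoint[of t s a] \<sigma>[of s] that by auto
  qed
  then show ?thesis using perm \<sigma> by blast
qed

lemma label_recovery:
  fixes \<pi> \<pi>' :: "nat \<Rightarrow> real" and h :: "nat \<Rightarrow> nat \<Rightarrow> real"
  assumes pos: "\<And>q. q < Q \<Longrightarrow> 0 < \<pi> q"
    and first_moment: "\<And>t. t < Q \<Longrightarrow> (\<Sum>a<Q. \<pi>' a * h t a) = \<pi> t * \<pi> t"
    and second_moment: "\<And>t. t < Q \<Longrightarrow> (\<Sum>a<Q. \<pi>' a * h t a * h t a) = \<pi> t * \<pi> t * \<pi> t"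
    and disjoint: "\<And>q s a. q < Q \<Longrightarrow> s < Q \<Longrightarrow> q \<noteq> s \<Longrightarrow> a < Q \<Longrightarrow> h q a * h s a = 0"
  shows "\<exists>\<sigma>. \<sigma> permutes {..<Q} \<and>
           (\<forall>t<Q. \<pi>' (\<sigma> t) = \<pi> t \<and> (\<forall>a<Q. h t a = (if a = \<sigma> t then \<pi> t else 0)))"
proof -
  have "\<exists>a<Q. h t a \<noteq> 0" if "t < Q" for t
  proof (rule ccontr)
    assume "\<not> ?thesis"
    then have "(\<Sum>a<Q. \<pi>' a * h t a) = 0" by (intro sum.neutral) auto
    then show False using first_moment[OF that] pos[OF that] by simp
  qed
  then obtain \<sigma> where perm: "\<sigma> permutes {..<Q}"
    and supp: "\<And>t a. t < Q \<Longrightarrow> a < Q \<Longrightarrow> h t a \<noteq> 0 \<longleftrightarrow> a = \<sigma> t"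
    using support_permutation[of Q h] disjoint by blast
  have \<sigma>Q: "\<sigma> t < Q" if "t < Q" for t using permutes_in_image[OF perm] that by simp
  have diagonal: "\<pi>' (\<sigma> t) = \<pi> t \<and> h t (\<sigma> t) = \<pi> t" if t: "t < Q" for t
  proof -
    have collapse: "(\<Sum>a<Q. \<pi>' a * h t a * F a) = \<pi>' (\<sigma> t) * h t (\<sigma> t) * F (\<sigma> t)" for F
      using supp[OF t] \<sigma>Q[OF t] by (subst sum.remove[of _ "\<sigma> t"]) (auto intro: sum.neutral)
    have 1: "\<pi>' (\<sigma> t) * h t (\<sigma> t) = \<pi> t * \<pi> t"
      using first_moment[OF t] collapse[of "\<lambda>_. 1"] by simp
    have "\<pi>' (\<sigma> t) * h t (\<sigma> t) * h t (\<sigma> t) = \<pi> t * \<pi> t * \<pi> t"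
      using second_moment[OF t] collapse[of "h t"] by simp
    then have "h t (\<sigma> t) = \<pi> t" using 1 pos[OF t] by simp
    then show ?thesis using 1 pos[OF t] by simp
  qed
  show ?thesis
    using perm diagonal supp by (intro exI[of _ \<sigma>]) (metis \<sigma>Q)
qed

(* Star moments of orders one, two and four in the dual test functions yield the
   hypotheses of label_recovery; this recovers \<pi> up to the permutation \<sigma>. *)
lemma group_recovery:
  assumes V: "valid_params Q \<kappa> \<pi> p" and V': "valid_params Q \<kappa> \<pi>' p'" and "6 \<le> n"
    and same: "\<And>\<psi>. moment n Q \<kappa> \<pi>' p' \<psi> = moment n Q \<kappa> \<pi> p \<psi>"
    and dual: "\<And>t a b. t < Q \<Longrightarrow> a < Q \<Longrightarrow> b < Q \<Longrightarrow>
                 edge_mean \<kappa> p (f t) a b = (if a = t \<and> b = t then 1 else 0)"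
  shows "\<exists>\<sigma>. \<sigma> permutes {..<Q} \<and> (\<forall>t<Q. \<pi>' (\<sigma> t) = \<pi> t \<and>
           (\<forall>a<Q. node_mean Q \<kappa> \<pi>' p' (f t) a = (if a = \<sigma> t then \<pi> t else 0)))"
proof -
  let ?H = "node_mean Q \<kappa> \<pi> p" and ?H' = "node_mean Q \<kappa> \<pi>' p'"
  have pos: "0 < \<pi> q" "0 < \<pi>' q" if "q < Q" for q
    using V V' that by (auto simp: valid_params_def)
  have Hf: "?H (f t) a = (if a = t then \<pi> t else 0)" if "t < Q" "a < Q" for t a
    using dual that by (intro node_mean_dual) auto
  have one: "?H (\<lambda>_. 1) a = 1" "?H' (\<lambda>_. 1) a = 1" if "a < Q" for a
    using node_mean_one V V' that by auto
  have star: "(\<Sum>a<Q. \<pi>' a * ?H' \<phi>1 a * ?H' \<phi>2 a * ?H' \<phi>3 a * ?H' \<phi>4 a)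
      = (\<Sum>a<Q. \<pi> a * ?H \<phi>1 a * ?H \<phi>2 a * ?H \<phi>3 a * ?H \<phi>4 a)" for \<phi>1 \<phi>2 \<phi>3 \<phi>4
    using same moment_star[OF V \<open>6 \<le> n\<close>] moment_star[OF V' \<open>6 \<le> n\<close>] by metis
  have first_moment: "(\<Sum>a<Q. \<pi>' a * ?H' (f t) a) = \<pi> t * \<pi> t" if t: "t < Q" for t
  proof -
    have "(\<Sum>a<Q. \<pi>' a * ?H' (f t) a) = (\<Sum>a<Q. \<pi> a * ?H (f t) a)"
      using star[of "f t" "\<lambda>_. 1" "\<lambda>_. 1" "\<lambda>_. 1"] one by simp
    also have "\<dots> = \<pi> t * \<pi> t" using t Hf by (subst sum_lessThan_single[of t]) auto
    finally show ?thesis .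
  qed
  have second_moment: "(\<Sum>a<Q. \<pi>' a * ?H' (f t) a * ?H' (f t) a) = \<pi> t * \<pi> t * \<pi> t"
    if t: "t < Q" for t
  proof -
    have "(\<Sum>a<Q. \<pi>' a * ?H' (f t) a * ?H' (f t) a) = (\<Sum>a<Q. \<pi> a * ?H (f t) a * ?H (f t) a)"
      using star[of "f t" "f t" "\<lambda>_. 1" "\<lambda>_. 1"] one by simp
    also have "\<dots> = \<pi> t * \<pi> t * \<pi> t" using t Hf by (subst sum_lessThan_single[of t]) auto
    finally show ?thesis .
  qed
  have disjoint: "?H' (f q) a * ?H' (f s) a = 0" if "q < Q" "s < Q" "q \<noteq> s" "a < Q" for q s a
  proof -
    have "(\<Sum>a<Q. \<pi>' a * (?H' (f q) a * ?H' (f s) a)\<^sup>2) = (\<Sum>a<Q. \<pi> a * (?H (f q) a * ?H (f s) a)\<^sup>2)"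
      using star[of "f q" "f q" "f s" "f s"] by (simp add: power2_eq_square mult_ac)
    also have "\<dots> = 0" using that Hf by (intro sum.neutral) auto
    finally have "(\<Sum>a<Q. \<pi>' a * (?H' (f q) a * ?H' (f s) a)\<^sup>2) = 0" .
    then have "\<pi>' a * (?H' (f q) a * ?H' (f s) a)\<^sup>2 = 0"
      using pos(2) \<open>a < Q\<close> by (subst (asm) sum_nonneg_eq_0_iff) (auto simp: less_imp_le)
    then show ?thesis using pos(2)[OF \<open>a < Q\<close>] by simp
  qed
  show ?thesis
    using label_recovery[of Q \<pi> \<pi>' "\<lambda>t. ?H' (f t)"] pos first_moment second_moment disjoint
    by blast
qed

(* The tree moment with the k-th unit vector on edge 0-1 and f q, f l on the edges 0-2, 1-5
   isolates \<pi> q\<^sup>2 \<pi> l\<^sup>2 p_ql(k), which recovers the edge laws along \<sigma>. *)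
lemma edge_law_recovery:
  assumes V: "valid_params Q \<kappa> \<pi> p" and V': "valid_params Q \<kappa> \<pi>' p'" and "6 \<le> n"
    and same: "\<And>\<psi>. moment n Q \<kappa> \<pi>' p' \<psi> = moment n Q \<kappa> \<pi> p \<psi>"
    and dual: "\<And>t a b. t < Q \<Longrightarrow> a < Q \<Longrightarrow> b < Q \<Longrightarrow>
                 edge_mean \<kappa> p (f t) a b = (if a = t \<and> b = t then 1 else 0)"
    and \<sigma>Q: "\<And>t. t < Q \<Longrightarrow> \<sigma> t < Q"
    and \<pi>': "\<And>t. t < Q \<Longrightarrow> \<pi>' (\<sigma> t) = \<pi> t"
    and H': "\<And>t a. t < Q \<Longrightarrow> a < Q \<Longrightarrow> node_mean Q \<kappa> \<pi>' p' (f t) a = (if a = \<sigma> t then \<pi> t else 0)"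
    and "q < Q" "l < Q" "k < \<kappa>"
  shows "p' (\<sigma> q) (\<sigma> l) k = p q l k"
proof -
  let ?H = "node_mean Q \<kappa> \<pi> p" and ?H' = "node_mean Q \<kappa> \<pi>' p'"
  define e :: "nat \<Rightarrow> real" where "e k' = (if k' = k then 1 else 0)" for k'
  have edge_e: "edge_mean \<kappa> r e a b = r a b k" for r a b
    using dot_unit[OF \<open>k < \<kappa>\<close>, of "r a b"] by (simp add: e_def edge_mean_def dot_def)
  have pos: "0 < \<pi> q" "0 < \<pi> l" using V \<open>q < Q\<close> \<open>l < Q\<close> by (auto simp: valid_params_def)
  have Hf: "?H (f t) a = (if a = t then \<pi> t else 0)" if "t < Q" "a < Q" for t a
    using dual that by (intro node_mean_dual) auto
  let ?\<psi> = "tree_test e (f q) (\<lambda>_. 1) (\<lambda>_. 1) (f l)"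
  have "moment n Q \<kappa> \<pi>' p' ?\<psi> = \<pi> q * \<pi> q * (\<pi> l * p' (\<sigma> q) (\<sigma> l) k * \<pi> l)"
  proof -
    have inner: "(\<Sum>b<Q. \<pi>' b * edge_mean \<kappa> p' e (\<sigma> q) b * ?H' (f l) b) = \<pi> l * p' (\<sigma> q) (\<sigma> l) k * \<pi> l"
      using assms(10) \<sigma>Q H' \<pi>' edge_e by (subst sum_lessThan_single[of "\<sigma> l"]) auto
    have "moment n Q \<kappa> \<pi>' p' ?\<psi>
        = \<pi>' (\<sigma> q) * \<pi> q * (\<Sum>b<Q. \<pi>' b * edge_mean \<kappa> p' e (\<sigma> q) b * ?H' (f l) b)"
      unfolding moment_tree[OF V' \<open>6 \<le> n\<close>]
      using assms(9) \<sigma>Q H' node_mean_one[OF V'] by (subst sum_lessThan_single[of "\<sigma> q"]) auto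
    then show ?thesis unfolding inner using \<pi>' assms(9) by simp
  qed
  moreover have "moment n Q \<kappa> \<pi> p ?\<psi> = \<pi> q * \<pi> q * (\<pi> l * p q l k * \<pi> l)"
  proof -
    have inner: "(\<Sum>b<Q. \<pi> b * edge_mean \<kappa> p e q b * ?H (f l) b) = \<pi> l * p q l k * \<pi> l"
      using assms(10) Hf edge_e by (subst sum_lessThan_single[of l]) auto
    have "moment n Q \<kappa> \<pi> p ?\<psi> = \<pi> q * \<pi> q * (\<Sum>b<Q. \<pi> b * edge_mean \<kappa> p e q b * ?H (f l) b)"
      unfolding moment_tree[OF V \<open>6 \<le> n\<close>]
      using assms(9) Hf node_mean_one[OF V] by (subst sum_lessThan_single[of q]) auto
    then show ?thesis unfolding inner .
  qed
  ultimately show ?thesis using same[of ?\<psi>] pos by simp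
qed

(* Identifiability from K_9 (only the sub-tree on 6 nodes is used; the bound on \<kappa> is
   implied by the independence hypothesis). The permutation of the statement is \<sigma>\<inverse>. *)
theorem theorem7:
  fixes Q \<kappa> :: nat and \<pi> \<pi>' :: "nat \<Rightarrow> real" and p p' :: "nat \<Rightarrow> nat \<Rightarrow> nat \<Rightarrow> real"
  assumes "Q \<ge> 2"
    and "valid_params Q \<kappa> \<pi> p"
    and "\<kappa> \<ge> (Q + 1) choose 2"
    and "lin_indep_ql Q \<kappa> p"
    and "valid_params Q \<kappa> \<pi>' p'"
    and "\<forall>x \<in> node_pairs 9 \<rightarrow>\<^sub>E {..<\<kappa>}. joint_prob 9 Q \<pi>' p' x = joint_prob 9 Q \<pi> p x"
  shows "\<exists>\<sigma>. \<sigma> permutes {..<Q} \<and> (\<forall>q<Q. \<pi>' q = \<pi> (\<sigma> q)) \<and>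
           (\<forall>q<Q. \<forall>l<Q. \<forall>k<\<kappa>. p' q l k = p (\<sigma> q) (\<sigma> l) k)"
proof -
  note V = assms(2) and V' = assms(5)
  have same: "moment 9 Q \<kappa> \<pi>' p' \<psi> = moment 9 Q \<kappa> \<pi> p \<psi>" for \<psi>
    using assms(6) by (rule moment_eq_if_joint_eq)
  obtain f where dual: "\<And>t a b. t < Q \<Longrightarrow> a < Q \<Longrightarrow> b < Q \<Longrightarrow>
      edge_mean \<kappa> p (f t) a b = (if a = t \<and> b = t then 1 else 0)"
    using dual_test_functions[OF V assms(4)] by blast
  obtain \<sigma> where perm: "\<sigma> permutes {..<Q}" and \<sigma>: "\<forall>t<Q. \<pi>' (\<sigma> t) = \<pi> t \<and>
      (\<forall>a<Q. node_mean Q \<kappa> \<pi>' p' (f t) a = (if a = \<sigma> t then \<pi> t else 0))"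
    using group_recovery[OF V V' _ same dual] by auto
  have \<sigma>Q: "\<sigma> t < Q" if "t < Q" for t using permutes_in_image[OF perm] that by simp
  have edges: "p' (\<sigma> q) (\<sigma> l) k = p q l k" if "q < Q" "l < Q" "k < \<kappa>" for q l k
    using edge_law_recovery[where \<sigma> = \<sigma>, OF V V' _ same dual \<sigma>Q] \<sigma> that by auto
  let ?\<tau> = "inv \<sigma>"
  have \<tau>: "?\<tau> permutes {..<Q}" "\<And>x. \<sigma> (?\<tau> x) = x" "\<And>x. x < Q \<Longrightarrow> ?\<tau> x < Q"
    using permutes_inv[OF perm] permutes_inverses(1)[OF perm] permutes_in_image[OF permutes_inv[OF perm]]
    by auto
  show ?thesis
    using \<tau> \<sigma> edges by (intro exI[of _ ?\<tau>]) metis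
qed

end
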